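(* Assume (A-f), (A-J), (A-TW), (A-5), (A-nd), and $J\in\mathbb{B}^\alpha_{1,\infty}(\Omega;\delta)$ for some $\alpha\in(0,1)$; let $(\phi,c)$ be as in (A-TW). Let $u(t,x)$ be the unique bounded entire solution of $\partial_tu=Lu+f(u)$ in $\mathbb{R}\times\overline\Omega$ with $|u(t,x)-\phi(x_1+ct)|\to0$ as $t\to-\infty$ uniformly in $x\in\overline\Omega$, and let $u_\infty\in C(\overline\Omega)$ be a solution of $Lu_\infty+f(u_\infty)=0$ in $\overline\Omega$, $u_\infty(x)\to1$ as $|x|\to\infty$, such that $|u(t,x)-u_\infty(x)\phi(x_1+ct)|\to0$ as $t\to+\infty$ locally uniformly in $x\in\overline\Omega$. Then $$\sup_{(t,x)\in\mathbb{R}\times\overline\Omega,\ x_1+ct\ge A}|u(t,x)-u_\infty(x)|\to0\quad\text{and}\quad\sup_{(t,x)\in\mathbb{R}\times\overline\Omega,\ x_1+ct\le-A}u(t,x)\to0\quad\text{as }A\to\infty.$$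
   Context: $K\subset\mathbb{R}^N$ is compact and $\Omega:=\mathbb{R}^N\setminus K$ is connected. A distance $\delta$ on $E\subset\mathbb{R}^N$ is quasi-Euclidean if $\delta(x,y)=|x-y|$ whenever $[x,y]\subset E$ and $\delta(x,y)\ge|x-y|$ for all $x,y\in E$; $\delta$ is a quasi-Euclidean distance on $\overline\Omega$. For measurable $J:[0,\infty)\to[0,\infty)$ with $|\mathrm{supp}(J)|>0$ and $x\in\overline\Omega$, $\Pi_0(J,x)=\{x\}$, $\Pi_{j+1}(J,x)=\bigcup_{z\in\Pi_j(J,x)}\mathrm{supp}(J(\delta(\cdot,z)))$; $(\Omega,\delta)$ has the $J$-covering property if $\overline\Omega=\bigcup_{j}\Pi_j(J,x)$ for all $x\in\overline\Omega$. Notation: $J_{\mathrm{rad}}(z)=J(|z|)$, $\mathcal{J}^\delta(x)=\int_\Omega J(\delta(x,z))dz$, $J_1(s)=\int_{\mathbb{R}^{N-1}}J_{\mathrm{rad}}(s,y')dy'$, $Lu(x)=\int_\Omega J(\delta(x,y))(u(y)-u(x))dy$; $x=(x_1,x')$. (A-f): $f:[0,1]\to\mathbb{R}$, $f\in C^{1,1}([0,1])$, $\exists\theta\in(0,1)$: $f(0)=f(\theta)=f(1)=0$, $f<0$ on $(0,\theta)$, $f>0$ on $(\theta,1)$, $f'(0)<0$, $f'(\theta)>0$, $f'(1)<0$. (A-J): $J$ measurable, compactly supported, $|\mathrm{supp}J|>0$; $(\Omega,\delta)$ has the $J$-covering property; $\int_{\mathbb{R}^N}J_{\mathrm{rad}}=1$;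 for every $y\in\overline\Omega$, $\|J(\delta(y,\cdot))-J(\delta(z,\cdot))\|_{L^1(\Omega)}\to0$ as $z\to y$; $\mathcal{J}^\delta\in L^\infty(\Omega)$. (A-TW): there exist increasing $\phi\in C(\mathbb{R})$, $c>0$ with $c\phi'=J_1*\phi-\phi+f(\phi)$, $\phi(-\infty)=0$, $\phi(+\infty)=1$. (A-5): $J_{\mathrm{rad}}\in W^{1,1}(\mathbb{R}^N)$, $\max_{[0,1]}f'<1$, $\int_0^1f>0$. (A-nd): $\max_{[0,1]}f'<\inf_\Omega\mathcal{J}^\delta$. $\mathbb{B}^\alpha_{1,\infty}(\Omega;\delta)$: $g:[0,\infty)\to\mathbb{R}$ with $g(|\cdot|)\in L^1(\mathbb{R}^N)$ and $\sup_{y\ne z\in\Omega}\|g(\delta(y,\cdot))-g(\delta(z,\cdot))\|_{L^1(\Omega)}/|y-z|^\alpha<\infty$. *)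

theory Defs
  imports "HOL-Analysis.Analysis"
begin

text \<open>Points of R^N are modelled as pairs (x1, x') :: real \<times> 'b, where 'b is an
  (N-1)-dimensional euclidean space; the norm on real \<times> 'b is the Euclidean one
  and lborel on the product is Lebesgue measure on R^N.\<close>

definition distance_on :: "'a set \<Rightarrow> ('a \<Rightarrow> 'a \<Rightarrow> real) \<Rightarrow> bool" where
  "distance_on E \<delta> \<longleftrightarrow>
     (\<forall>x\<in>E. \<forall>y\<in>E. 0 \<le> \<delta> x y \<and> (\<delta> x y = 0 \<longleftrightarrow> x = y) \<and> \<delta> x y = \<delta> y x) \<and>
     (\<forall>x\<in>E. \<forall>y\<in>E. \<forall>z\<in>E. \<delta> x z \<le> \<delta> x y + \<delta> y z)"

definition quasi_euclidean :: "'a::real_normed_vector set \<Rightarrow> ('a \<Rightarrow> 'a \<Rightarrow> real) \<Rightarrow> bool" where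
  "quasi_euclidean E \<delta> \<longleftrightarrow> distance_on E \<delta> \<and>
     (\<forall>x\<in>E. \<forall>y\<in>E. closed_segment x y \<subseteq> E \<longrightarrow> \<delta> x y = dist x y) \<and>
     (\<forall>x\<in>E. \<forall>y\<in>E. \<delta> x y \<ge> dist x y)"

definition supp_on :: "'a::topological_space set \<Rightarrow> ('a \<Rightarrow> real) \<Rightarrow> 'a set" where
  "supp_on D g = closure {x\<in>D. g x \<noteq> 0}"

fun Pi_set :: "(real \<Rightarrow> real) \<Rightarrow> ('a::topological_space \<Rightarrow> 'a \<Rightarrow> real) \<Rightarrow> 'a set \<Rightarrow> 'a \<Rightarrow> nat \<Rightarrow> 'a set" where
  "Pi_set J \<delta> Ob x 0 = {x}"
| "Pi_set J \<delta> Ob x (Suc j) = (\<Union>z\<in>Pi_set J \<delta> Ob x j. supp_on Ob (\<lambda>y. J (\<delta> y z)))"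

definition covering_property :: "(real \<Rightarrow> real) \<Rightarrow> ('a::topological_space \<Rightarrow> 'a \<Rightarrow> real) \<Rightarrow> 'a set \<Rightarrow> bool" where
  "covering_property J \<delta> Ob \<longleftrightarrow> (\<forall>x\<in>Ob. Ob = (\<Union>j. Pi_set J \<delta> Ob x j))"

definition nonlocal_L :: "(real \<Rightarrow> real) \<Rightarrow> ('a::euclidean_space \<Rightarrow> 'a \<Rightarrow> real) \<Rightarrow> 'a set \<Rightarrow> ('a \<Rightarrow> real) \<Rightarrow> 'a \<Rightarrow> real" where
  "nonlocal_L J \<delta> \<Omega> u x = (\<integral>y. indicator \<Omega> y * (J (\<delta> x y) * (u y - u x)) \<partial>lborel)"

definition calJ :: "(real \<Rightarrow> real) \<Rightarrow> ('a::euclidean_space \<Rightarrow> 'a \<Rightarrow> real) \<Rightarrow> 'a set \<Rightarrow> 'a \<Rightarrow> ennreal" where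
  "calJ J \<delta> \<Omega> x = (\<integral>\<^sup>+ z. indicator \<Omega> z * ennreal (J (\<delta> x z)) \<partial>lborel)"

definition L1_diff :: "(real \<Rightarrow> real) \<Rightarrow> ('a::euclidean_space \<Rightarrow> 'a \<Rightarrow> real) \<Rightarrow> 'a set \<Rightarrow> 'a \<Rightarrow> 'a \<Rightarrow> ennreal" where
  "L1_diff g \<delta> \<Omega> y z = (\<integral>\<^sup>+ w. indicator \<Omega> w * ennreal \<bar>g (\<delta> y w) - g (\<delta> z w)\<bar> \<partial>lborel)"

definition J_one :: "(real \<Rightarrow> real) \<Rightarrow> 'b::euclidean_space itself \<Rightarrow> real \<Rightarrow> real" where
  "J_one J _ s = (\<integral>y'. J (norm (s, y'::'b)) \<partial>lborel)"

definition besov_class :: "real \<Rightarrow> 'a::euclidean_space set \<Rightarrow> ('a \<Rightarrow> 'a \<Rightarrow> real) \<Rightarrow> (real \<Rightarrow> real) set" where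
  "besov_class \<alpha> \<Omega> \<delta> = {g. integrable lborel (\<lambda>x::'a. g (norm x)) \<and>
     (\<exists>C. \<forall>y\<in>\<Omega>. \<forall>z\<in>\<Omega>. y \<noteq> z \<longrightarrow> L1_diff g \<delta> \<Omega> y z \<le> ennreal (C * dist y z powr \<alpha>))}"

definition test_fun :: "('a::euclidean_space \<Rightarrow> real) \<Rightarrow> ('a \<Rightarrow> 'a) \<Rightarrow> bool" where
  "test_fun \<phi> D\<phi> \<longleftrightarrow> (\<forall>x. (\<phi> has_derivative (\<lambda>h. D\<phi> x \<bullet> h)) (at x)) \<and>
     continuous_on UNIV D\<phi> \<and> compact (closure {x. \<phi> x \<noteq> 0})"

definition W11 :: "('a::euclidean_space \<Rightarrow> real) set" where
  "W11 = {g. integrable lborel g \<and>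
     (\<exists>G::'a \<Rightarrow> 'a. (\<forall>i\<in>Basis. integrable lborel (\<lambda>x. G x \<bullet> i)) \<and>
        (\<forall>\<phi> D\<phi>. test_fun \<phi> D\<phi> \<longrightarrow> (\<forall>i\<in>Basis.
           (\<integral>x. g x * (D\<phi> x \<bullet> i) \<partial>lborel) = - (\<integral>x. (G x \<bullet> i) * \<phi> x \<partial>lborel))))}"

end

theory Submission
  imports Defs
begin

text \<open>Outside a large ball the operator \<open>L\<close> is exactly the convolution operator
  \<open>v \<mapsto> J\<^sub>r\<^sub>a\<^sub>d * v - v\<close>, because \<open>J\<close> has compact support and \<open>\<delta>\<close> is Euclidean along segments
  avoiding the obstacle.  There \<open>u\<close> is trapped, from a very negative time on, between
  Fife--McLeod sub- and supersolutions, i.e. translates of the front \<open>\<phi> (x\<^sub>1 + c t)\<close> with bounded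
  shifts and small additive errors.  Near the obstacle the additive error dominates the
  discrepancy between \<open>u\<close> and \<open>1\<close>: for late times by the convergence to
  \<open>uinf\<close>, for earlier times by choosing the initial shift large.  Inside the ball the claims
  follow from the local convergence alone.\<close>

lemma comparison_nonpos:
  fixes v :: "real \<Rightarrow> 'a \<Rightarrow> real"
  assumes bdd: "\<And>t x. t \<ge> T \<Longrightarrow> x \<in> E \<Longrightarrow> v t x \<le> B"
    and init: "\<And>x. x \<in> E \<Longrightarrow> v T x \<le> 0"
    and cont: "\<And>x. x \<in> E \<Longrightarrow> continuous_on {T..} (\<lambda>t. v t x)"
    and deriv: "\<And>t x. t \<ge> T \<Longrightarrow> x \<in> E \<Longrightarrow> v t x > 0 \<Longrightarrow>
      \<exists>D. ((\<lambda>s. v s x) has_real_derivative D) (at t) \<and>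
          (\<forall>m\<ge>0. (\<forall>y\<in>E. v t y \<le> m) \<longrightarrow> D \<le> \<Lambda> * m)"
    and Lpos: "\<Lambda> > 0" and t: "t \<ge> T" and x: "x \<in> E"
  shows "v t x \<le> 0"
proof -
  define g where "g = (\<lambda>(t, x). exp (- 2 * \<Lambda> * (t - T)) * max 0 (v t x))"
  define A where "A = g ` ({T..} \<times> E)"
  define N where "N = Sup A"
  have g_le: "g (t, x) \<le> max 0 B" if "t \<ge> T" "x \<in> E" for t x
  proof -
    have "exp (- 2 * \<Lambda> * (t - T)) * max 0 (v t x) \<le> 1 * max 0 B"
      using that Lpos bdd[OF that] by (intro mult_mono) (auto simp: mult_nonneg_nonneg)
    then show ?thesis by (simp add: g_def)
  qed
  have bddA: "bdd_above A" unfolding A_def using g_le by (force intro!: bdd_aboveI)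
  have gN: "g (t, x) \<le> N" if "t \<ge> T" "x \<in> E" for t x
    unfolding N_def by (rule cSup_upper[OF _ bddA]) (use that in \<open>auto simp: A_def\<close>)
  have N0: "0 \<le> N"
    using gN[OF t x] order_trans[of 0 "g (t,x)" N] by (auto simp: g_def)
  have v_le: "v t x \<le> N * exp (2 * \<Lambda> * (t - T))" if "t \<ge> T" "x \<in> E" for t x
  proof -
    have "v t x \<le> max 0 (v t x)" by simp
    also have "\<dots> = g (t, x) * exp (2 * \<Lambda> * (t - T))"
      by (simp add: g_def mult_exp_exp[symmetric] algebra_simps flip: exp_add)
    also have "\<dots> \<le> N * exp (2 * \<Lambda> * (t - T))"
      using gN[OF that] by (intro mult_right_mono) auto
    finally show ?thesis .
  qed
  have half: "v t x \<le> N / 2 * exp (2 * \<Lambda> * (t - T))" if t: "t \<ge> T" and x: "x \<in> E" for t x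
  proof (rule ccontr)
    define h where "h = (\<lambda>t. N / 2 * exp (2 * \<Lambda> * (t - T)))"
    assume "\<not> ?thesis"
    then have gt: "v t x > h t" by (simp add: h_def)
    have h0: "h s \<ge> 0" for s using N0 by (simp add: h_def)
    define S where "S = {s \<in> {T..t}. v s x \<le> 0}"
    have "closed S"
    proof -
      have "continuous_on {T..t} (\<lambda>s. v s x)"
        using cont[OF x] by (rule continuous_on_subset) auto
      then show ?thesis unfolding S_def
        using continuous_closed_preimage[of "{T..t}" "\<lambda>s. v s x" "{..0}"]
        by (simp add: vimage_def Int_def conj_commute)
    qed
    moreover have "bounded S" by (rule bounded_subset[of "{T..t}"]) (auto simp: S_def)
    ultimately have "compact S" by (simp add: compact_eq_bounded_closed)
    moreover have "T \<in> S" using init[OF x] t by (auto simp: S_def)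
    ultimately obtain t0 where t0: "t0 \<in> S" "\<And>s. s \<in> S \<Longrightarrow> s \<le> t0"
      using compact_attains_sup[of S] by blast
    have t0t: "t0 < t"
      using t0(1) gt h0[of t] by (cases "t0 = t") (auto simp: S_def)
    have pos: "v s x > 0" if "t0 < s" "s \<le> t" for s
      using t0(1) t0(2)[of s] that by (force simp: S_def)
    have "v t x - h t \<le> v t0 x - h t0"
    proof (rule DERIV_nonpos_imp_decreasing_open[OF less_imp_le[OF t0t]])
      fix s assume s: "t0 < s" "s < t"
      have sT: "s \<ge> T" using s t0(1) by (auto simp: S_def)
      obtain D where D: "((\<lambda>s. v s x) has_real_derivative D) (at s)"
        and "\<forall>m\<ge>0. (\<forall>y\<in>E. v s y \<le> m) \<longrightarrow> D \<le> \<Lambda> * m"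
        using deriv[OF sT x pos] s by auto
      then have Dle: "D \<le> \<Lambda> * (N * exp (2 * \<Lambda> * (s - T)))"
        using v_le[OF sT] N0 by auto
      have "((\<lambda>s. v s x - h s) has_real_derivative D - \<Lambda> * (N * exp (2 * \<Lambda> * (s - T)))) (at s)"
        unfolding h_def by (auto intro!: derivative_eq_intros D)
      then show "\<exists>y. ((\<lambda>s. v s x - h s) has_real_derivative y) (at s) \<and> y \<le> 0"
        using Dle by (intro exI conjI) auto
    next
      show "continuous_on {t0..t} (\<lambda>s. v s x - h s)"
        unfolding h_def using t0(1)
        by (intro continuous_intros continuous_on_subset[OF cont[OF x]]) (auto simp: S_def)
    qed
    then show False using gt h0[of t0] t0(1) by (auto simp: S_def)
  qed
  have "g (t, x) \<le> N / 2" if "t \<ge> T" "x \<in> E" for t x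
  proof -
    have "max 0 (v t x) \<le> N / 2 * exp (2 * \<Lambda> * (t - T))" using half[OF that] N0 by (intro max.boundedI) auto
    then have "g (t, x) \<le> exp (- 2 * \<Lambda> * (t - T)) * (N / 2 * exp (2 * \<Lambda> * (t - T)))"
      unfolding g_def by (simp only: prod.case) (intro mult_left_mono, auto)
    also have "\<dots> = N / 2" by (simp add: algebra_simps flip: exp_add)
    finally show ?thesis .
  qed
  then have "N \<le> N / 2" unfolding N_def
    by (intro cSup_least) (use t x in \<open>auto simp: A_def\<close>)
  then have "N \<le> 0" by simp
  then show ?thesis using v_le[OF t x] N0 by simp
qed

text \<open>The increments \<open>D = \<phi> (\<cdot> + h) - \<phi>\<close> satisfy \<open>c D' \<ge> - (1 + C) D\<close>, so a positive slope
  survives to the right, and \<open>\<phi>\<close> must rise somewhere to the left of any point where \<open>\<phi> \<ge> \<sigma>\<close>.\<close>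

lemma wave_slope_lower_bound:
  fixes \<phi> f Cv :: "real \<Rightarrow> real"
  assumes mono: "mono \<phi>" and rng: "\<And>\<xi>. 0 \<le> \<phi> \<xi> \<and> \<phi> \<xi> \<le> 1" and c: "c > 0"
    and der: "\<And>\<xi>. (\<phi> has_real_derivative ((Cv \<xi> - \<phi> \<xi> + f (\<phi> \<xi>)) / c)) (at \<xi>)"
    and Cv: "mono Cv"
    and flip: "\<And>a b. 0 \<le> a \<Longrightarrow> a \<le> b \<Longrightarrow> b \<le> 1 \<Longrightarrow> \<bar>f b - f a\<bar> \<le> C * (b - a)"
    and bot: "(\<phi> \<longlongrightarrow> 0) at_bot" and \<sigma>: "\<sigma> > 0"
  shows "\<exists>\<kappa>>0. \<forall>\<xi>\<le>M. \<sigma> \<le> \<phi> \<xi> \<longrightarrow> \<kappa> \<le> (Cv \<xi> - \<phi> \<xi> + f (\<phi> \<xi>)) / c"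
proof -
  define \<psi> where "\<psi> \<xi> = (Cv \<xi> - \<phi> \<xi> + f (\<phi> \<xi>)) / c" for \<xi>
  define L where "L = (1 + C) / c"
  have C0: "C \<ge> 0" using flip[of 0 1] by simp
  have L0: "L \<ge> 0" using C0 c by (simp add: L_def)
  have der': "(\<phi> has_real_derivative \<psi> \<xi>) (at \<xi>)" for \<xi> using der by (simp add: \<psi>_def)
  have incr: "exp (- L * (\<xi> - s)) * (\<phi> (s + h) - \<phi> s) \<le> \<phi> (\<xi> + h) - \<phi> \<xi>"
    if h: "h > 0" and s: "s \<le> \<xi>" for h s \<xi>
  proof -
    have "exp (L * s) * (\<phi> (s + h) - \<phi> s) \<le> exp (L * \<xi>) * (\<phi> (\<xi> + h) - \<phi> \<xi>)"
    proof (rule DERIV_nonneg_imp_nondecreasing[OF s])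
      fix z
      have d: "((\<lambda>z. \<phi> (z + h)) has_real_derivative \<psi> (z + h)) (at z)"
        using der'[of "z + h"] by (simp add: DERIV_shift)
      have "((\<lambda>z. exp (L * z) * (\<phi> (z + h) - \<phi> z)) has_real_derivative
          exp (L * z) * (L * (\<phi> (z + h) - \<phi> z) + (\<psi> (z + h) - \<psi> z))) (at z)"
        by (auto intro!: derivative_eq_intros d der' simp: algebra_simps)
      moreover have "0 \<le> L * (\<phi> (z + h) - \<phi> z) + (\<psi> (z + h) - \<psi> z)"
      proof -
        have m: "\<phi> z \<le> \<phi> (z + h)" "Cv z \<le> Cv (z + h)"
          using mono Cv h by (auto simp: mono_def)
        have "\<bar>f (\<phi> (z + h)) - f (\<phi> z)\<bar> \<le> C * (\<phi> (z + h) - \<phi> z)"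
          using rng m by (intro flip) auto
        then have "0 \<le> ((1 + C) * (\<phi> (z + h) - \<phi> z) + ((Cv (z + h) - \<phi> (z + h) + f (\<phi> (z + h))) - (Cv z - \<phi> z + f (\<phi> z)))) / c"
          using m c by (intro divide_nonneg_pos) (auto simp: algebra_simps)
        also have "\<dots> = L * (\<phi> (z + h) - \<phi> z) +
            ((Cv (z + h) - \<phi> (z + h) + f (\<phi> (z + h))) - (Cv z - \<phi> z + f (\<phi> z))) / c"
          unfolding L_def times_divide_eq_left by (rule add_divide_distrib)
        also have "\<dots> = L * (\<phi> (z + h) - \<phi> z) + (\<psi> (z + h) - \<psi> z)"
          unfolding \<psi>_def by (simp only: diff_divide_distrib)
        finally show ?thesis .
      qed
      ultimately show "\<exists>y. ((\<lambda>z. exp (L * z) * (\<phi> (z + h) - \<phi> z)) has_real_derivative y) (at z) \<and> 0 \<le> y"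
        by (intro exI[of _ "exp (L * z) * (L * (\<phi> (z + h) - \<phi> z) + (\<psi> (z + h) - \<psi> z))"] conjI mult_nonneg_nonneg) auto
    qed
    then have "exp (- L * \<xi>) * (exp (L * s) * (\<phi> (s + h) - \<phi> s)) \<le> exp (- L * \<xi>) * (exp (L * \<xi>) * (\<phi> (\<xi> + h) - \<phi> \<xi>))"
      by (intro mult_left_mono) auto
    moreover have "exp (- L * \<xi>) * exp (L * s) = exp (- L * (\<xi> - s))"
      by (simp add: algebra_simps flip: exp_add)
    moreover have "exp (- L * \<xi>) * exp (L * \<xi>) = 1" by (simp flip: exp_add)
    ultimately show ?thesis by (simp only: mult.assoc[symmetric]) simp
  qed
  have slope: "exp (- L * (\<xi> - s)) * \<psi> s \<le> \<psi> \<xi>" if s: "s \<le> \<xi>" for s \<xi>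
  proof (rule tendsto_le)
    show "((\<lambda>h. (\<phi> (\<xi> + h) - \<phi> \<xi>) / h) \<longlongrightarrow> \<psi> \<xi>) (at_right 0)"
      using der'[of \<xi>] unfolding DERIV_def by (rule tendsto_within_subset) auto
    have "((\<lambda>h. (\<phi> (s + h) - \<phi> s) / h) \<longlongrightarrow> \<psi> s) (at_right 0)"
      using der'[of s] unfolding DERIV_def by (rule tendsto_within_subset) auto
    then show "((\<lambda>h. exp (- L * (\<xi> - s)) * ((\<phi> (s + h) - \<phi> s) / h)) \<longlongrightarrow> exp (- L * (\<xi> - s)) * \<psi> s) (at_right 0)"
      by (intro tendsto_intros)
    show "\<forall>\<^sub>F h in at_right 0. exp (- L * (\<xi> - s)) * ((\<phi> (s + h) - \<phi> s) / h) \<le> (\<phi> (\<xi> + h) - \<phi> \<xi>) / h"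
      unfolding eventually_at_filter
      by (rule always_eventually) (use incr[OF _ s] in \<open>auto simp: divide_right_mono\<close>)
  qed simp
  have "\<forall>\<^sub>F \<alpha> in at_bot. \<phi> \<alpha> < \<sigma> / 2" using bot \<sigma> by (intro order_tendstoD) auto
  then obtain \<alpha>0 where \<alpha>0: "\<And>\<alpha>. \<alpha> \<le> \<alpha>0 \<Longrightarrow> \<phi> \<alpha> < \<sigma> / 2"
    by (auto simp: eventually_at_bot_linorder)
  define \<alpha> where "\<alpha> = min \<alpha>0 (M - 1)"
  have \<alpha>: "\<phi> \<alpha> < \<sigma> / 2" "\<alpha> < M" using \<alpha>0 by (auto simp: \<alpha>_def)
  define \<kappa> where "\<kappa> = exp (- L * (M - \<alpha>)) * (\<sigma> / 2 / (M - \<alpha>))"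
  have "\<kappa> > 0" using \<alpha> \<sigma> by (simp add: \<kappa>_def)
  moreover have "\<kappa> \<le> \<psi> \<xi>" if \<xi>: "\<xi> \<le> M" "\<sigma> \<le> \<phi> \<xi>" for \<xi>
  proof -
    have a: "\<alpha> < \<xi>" using \<alpha> \<xi> \<sigma> monoD[OF mono, of \<xi> \<alpha>] by (cases "\<alpha> < \<xi>") auto
    obtain s where s: "\<alpha> < s" "s < \<xi>" and eq: "\<phi> \<xi> - \<phi> \<alpha> = (\<xi> - \<alpha>) * \<psi> s"
      using MVT2[OF a, of \<phi> \<psi>] der' by blast
    have "\<sigma> / 2 / (M - \<alpha>) \<le> (\<phi> \<xi> - \<phi> \<alpha>) / (\<xi> - \<alpha>)"
      using \<alpha> \<xi> \<sigma> a by (intro frac_le) auto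
    also have "\<dots> = \<psi> s" using eq a by simp
    finally have 1: "\<sigma> / 2 / (M - \<alpha>) \<le> \<psi> s" .
    have "L * (\<xi> - s) \<le> L * (M - \<alpha>)" using s \<xi> L0 by (intro mult_left_mono) auto
    then have "\<kappa> \<le> exp (- L * (\<xi> - s)) * \<psi> s"
      unfolding \<kappa>_def using 1 \<sigma> \<alpha> by (intro mult_mono) auto
    also have "\<dots> \<le> \<psi> \<xi>" using slope s by auto
    finally show ?thesis .
  qed
  ultimately show ?thesis unfolding \<psi>_def by blast
qed

lemma bistable_bounds:
  fixes f fd :: "real \<Rightarrow> real"
  assumes der: "\<And>s. s \<in> {0..1} \<Longrightarrow> (f has_real_derivative fd s) (at s within {0..1})"
    and cont: "continuous_on {0..1} fd" and neg: "fd 0 < 0" "fd 1 < 0"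
  shows "\<exists>C\<ge>0. \<exists>\<mu>>0. \<exists>\<sigma>>0.
    (\<forall>a b. 0 \<le> a \<longrightarrow> a \<le> b \<longrightarrow> b \<le> 1 \<longrightarrow> \<bar>f b - f a\<bar> \<le> C * (b - a)) \<and>
    (\<forall>a b. 0 \<le> a \<longrightarrow> a \<le> b \<longrightarrow> b \<le> 1 \<longrightarrow> b \<le> 2 * \<sigma> \<or> a \<ge> 1 - 2 * \<sigma> \<longrightarrow> f b - f a \<le> - \<mu> * (b - a))"
proof -
  have mvt: "\<exists>z. a \<le> z \<and> z \<le> b \<and> f b - f a = (b - a) * fd z" if "0 \<le> a" "a \<le> b" "b \<le> 1" for a b
  proof (cases "a = b")
    case False
    have "\<exists>z\<in>{a<..<b}. f b - f a = (\<lambda>h. h * fd z) (b - a)"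
    proof (rule mvt)
      show "continuous_on {a..b} f"
        by (rule continuous_on_subset[OF DERIV_continuous_on[OF der]]) (use that in auto)
      fix x assume x: "a < x" "x < b"
      then have "(f has_real_derivative fd x) (at x)"
        using der[of x] that by (simp add: at_within_Icc_at)
      then show "(f has_derivative (\<lambda>h. h * fd x)) (at x)"
        by (simp add: has_field_derivative_def mult.commute[of _ "fd x"])
    qed (use False that in auto)
    then show ?thesis by (auto simp: Bex_def intro: less_imp_le)
  qed auto
  have "bounded (fd ` {0..1})"
    by (rule compact_imp_bounded[OF compact_continuous_image[OF cont compact_Icc]])
  then obtain C where "\<forall>y \<in> fd ` {0..1}. \<bar>y\<bar> \<le> C" unfolding bounded_iff by auto
  then have C: "\<bar>fd s\<bar> \<le> C" if "s \<in> {0..1}" for s using that by blast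
  have C0: "C \<ge> 0" using C[of 0] by auto
  define \<mu> where "\<mu> = min (- fd 0) (- fd 1) / 2"
  have \<mu>: "\<mu> > 0" "fd 0 < - \<mu>" "fd 1 < - \<mu>" using neg by (auto simp: \<mu>_def)
  obtain d0 where d0: "d0 > 0" "\<And>x. x \<in> {0..1} \<Longrightarrow> dist x 0 < d0 \<Longrightarrow> dist (fd x) (fd 0) < - \<mu> - fd 0"
    using cont \<mu> unfolding continuous_on_iff by (metis atLeastAtMost_iff diff_gt_0_iff_gt order_refl zero_le_one)
  obtain d1 where d1: "d1 > 0" "\<And>x. x \<in> {0..1} \<Longrightarrow> dist x 1 < d1 \<Longrightarrow> dist (fd x) (fd 1) < - \<mu> - fd 1"
    using cont \<mu> unfolding continuous_on_iff by (metis atLeastAtMost_iff diff_gt_0_iff_gt order_refl zero_le_one)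
  define \<sigma> where "\<sigma> = min d0 d1 / 3"
  have \<sigma>: "\<sigma> > 0" "2 * \<sigma> < d0" "2 * \<sigma> < d1" using d0 d1 by (auto simp: \<sigma>_def)
  have "\<bar>f b - f a\<bar> \<le> C * (b - a)" if ab: "0 \<le> a" "a \<le> b" "b \<le> 1" for a b
  proof -
    obtain z where z: "a \<le> z" "z \<le> b" "f b - f a = (b - a) * fd z" using mvt[OF ab] by blast
    then show ?thesis using C[of z] ab
      by (simp add: abs_mult mult.commute[of C] mult_left_mono)
  qed
  moreover have "f b - f a \<le> - \<mu> * (b - a)"
    if ab: "0 \<le> a" "a \<le> b" "b \<le> 1" and e: "b \<le> 2 * \<sigma> \<or> a \<ge> 1 - 2 * \<sigma>" for a b
  proof -
    obtain z where z: "a \<le> z" "z \<le> b" "f b - f a = (b - a) * fd z" using mvt[OF ab] by blast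
    have "fd z \<le> - \<mu>"
      using e d0(2)[of z] d1(2)[of z] z ab \<sigma> by (auto simp: dist_real_def)
    then have "(b - a) * fd z \<le> (b - a) * - \<mu>" using ab by (intro mult_left_mono) auto
    then show ?thesis using z by (simp add: mult.commute)
  qed
  ultimately show ?thesis using C0 \<mu>(1) \<sigma>(1) by blast
qed

lemma
  fixes g :: "'a::euclidean_space \<Rightarrow> real"
  assumes g: "integrable lborel g"
  shows integrable_lborel_translate: "integrable lborel (\<lambda>y. g (y - x))"
    and integral_lborel_translate: "(\<integral>y. g (y - x) \<partial>lborel) = (\<integral>y. g y \<partial>lborel)"
proof -
  have "integrable (distr lborel borel ((+) (- x))) g" using g by (simp add: lborel_distr_plus)
  then show "integrable lborel (\<lambda>y. g (y - x))"
    using g by (subst (asm) integrable_distr_eq) (auto simp: algebra_simps)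
  have "(\<integral>y. g y \<partial>lborel) = (\<integral>y. g y \<partial>distr lborel borel ((+) (- x)))"
    by (simp add: lborel_distr_plus)
  also have "\<dots> = (\<integral>y. g (- x + y) \<partial>lborel)"
    using g by (intro integral_distr) auto
  finally show "(\<integral>y. g (y - x) \<partial>lborel) = (\<integral>y. g y \<partial>lborel)" by simp
qed

lemma integrable_mult_bounded:
  fixes k w :: "'a::euclidean_space \<Rightarrow> real"
  assumes k: "integrable lborel k" and w: "w \<in> borel_measurable lborel" and B: "\<And>y. \<bar>w y\<bar> \<le> B"
  shows "integrable lborel (\<lambda>y. k y * w y)"
proof (rule Bochner_Integration.integrable_bound[of _ "\<lambda>y. B * k y"])
  show "AE y in lborel. norm (k y * w y) \<le> norm (B * k y)"
  proof (rule AE_I2)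
    fix y
    have "\<bar>k y\<bar> * \<bar>w y\<bar> \<le> \<bar>k y\<bar> * \<bar>B\<bar>"
      using order_trans[OF B[of y] abs_ge_self] by (intro mult_left_mono) auto
    then show "norm (k y * w y) \<le> norm (B * k y)" by (simp add: abs_mult mult.commute)
  qed
qed (use k w in auto)

lemma convolution_first_coordinate:
  fixes J \<phi> :: "real \<Rightarrow> real" and x :: "real \<times> 'b::euclidean_space"
  assumes J: "integrable lborel (\<lambda>x::real \<times> 'b. J (norm x))"
    and \<phi>: "\<phi> \<in> borel_measurable borel" and B: "\<And>\<xi>. \<bar>\<phi> \<xi>\<bar> \<le> B"
  shows "(\<integral>y. J (norm (x - y)) * \<phi> (fst y + b) \<partial>lborel) =
    (\<integral>s. J_one J TYPE('b) (fst x + b - s) * \<phi> s \<partial>lborel)"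
proof -
  define \<xi> where "\<xi> = fst x + b"
  have int: "integrable lborel (\<lambda>z::real \<times> 'b. J (norm z) * \<phi> (fst z + \<xi>))"
  proof (rule integrable_mult_bounded[OF J _ B])
    show "(\<lambda>z::real \<times> 'b. \<phi> (fst z + \<xi>)) \<in> borel_measurable lborel"
      by (rule measurable_compose[OF _ \<phi>])
        (simp, intro borel_measurable_continuous_onI continuous_intros)
  qed
  have J1: "J_one J TYPE('b) (- s) = J_one J TYPE('b) s" for s
    by (simp add: J_one_def norm_Pair)
  have "(\<integral>y. J (norm (x - y)) * \<phi> (fst y + b) \<partial>lborel) =
      (\<integral>y. J (norm (y - x)) * \<phi> (fst (y - x) + \<xi>) \<partial>lborel)"
    by (simp add: \<xi>_def norm_minus_commute)
  also have "\<dots> = (\<integral>z. J (norm (z::real \<times> 'b)) * \<phi> (fst z + \<xi>) \<partial>lborel)"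
    by (rule integral_lborel_translate[OF int])
  also have "\<dots> = (\<integral>s. (\<integral>y'. J (norm (s, y'::'b)) * \<phi> (s + \<xi>) \<partial>lborel) \<partial>lborel)"
    using lborel_pair.integral_fst'[of "\<lambda>z::real \<times> 'b. J (norm z) * \<phi> (fst z + \<xi>)"] int
    by (simp add: lborel_prod)
  also have "\<dots> = (\<integral>s. J_one J TYPE('b) s * \<phi> (s + \<xi>) \<partial>lborel)"
    by (simp add: J_one_def)
  also have "\<dots> = (\<integral>s. J_one J TYPE('b) (- \<xi> + 1 * s) * \<phi> (- \<xi> + 1 * s + \<xi>) \<partial>lborel)"
    by (subst lborel_integral_real_affine[where c=1 and t="-\<xi>"]) auto
  also have "\<dots> = (\<integral>s. J_one J TYPE('b) (\<xi> - s) * \<phi> s \<partial>lborel)"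
    using J1[of "\<xi> - _"] by simp
  finally show ?thesis by (simp add: \<xi>_def)
qed

lemma nonlocal_L_exterior:
  fixes K \<Omega> :: "'a::euclidean_space set"
  assumes K: "\<And>z. z \<in> K \<Longrightarrow> norm z < R0" and Omega: "\<Omega> = - K"
    and qe: "quasi_euclidean (closure \<Omega>) \<delta>" and J: "\<And>s. s \<ge> \<rho> \<Longrightarrow> J s = 0"
    and x: "norm x \<ge> R0 + \<rho>" and \<rho>: "\<rho> > 0"
  shows "nonlocal_L J \<delta> \<Omega> u x =
    (\<integral>y. indicator {y. R0 \<le> norm y} y * (J (norm (x - y)) * (u y - u x)) \<partial>lborel)"
  unfolding nonlocal_L_def
proof (rule Bochner_Integration.integral_cong[OF refl])
  fix y
  have sub: "\<Omega> \<subseteq> closure \<Omega>" by (rule closure_subset)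
  have xO: "x \<in> \<Omega>" using K[of x] x \<rho> Omega by force
  have far: "J (norm (x - y)) = 0" if "norm y < R0"
    using norm_triangle_sub[of x y] that x by (intro J) auto
  show "indicator \<Omega> y * (J (\<delta> x y) * (u y - u x)) =
    indicator {y. R0 \<le> norm y} y * (J (norm (x - y)) * (u y - u x))"
  proof (cases "y \<in> \<Omega>")
    case False
    then show ?thesis using K[of y] Omega by simp
  next
    case True
    have "J (\<delta> x y) = J (norm (x - y))"
    proof (cases "dist x y < \<rho>")
      case close: True
      have "closed_segment x y \<subseteq> \<Omega>"
      proof
        fix z assume z: "z \<in> closed_segment x y"
        have "dist x z \<le> dist x y"
          using dist_in_closed_segment[OF z] by (simp add: dist_commute)
        then have "norm z > R0"
          using norm_triangle_sub[of x z] x close by (auto simp: dist_norm)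
        then show "z \<in> \<Omega>" using K[of z] Omega by force
      qed
      then have "\<delta> x y = dist x y"
        using qe True xO sub unfolding quasi_euclidean_def by blast
      then show ?thesis by (simp add: dist_norm)
    next
      case False
      moreover have "\<delta> x y \<ge> dist x y"
        using qe True xO sub unfolding quasi_euclidean_def by blast
      ultimately show ?thesis using J[of "\<delta> x y"] J[of "dist x y"] by (simp add: dist_norm)
    qed
    then show ?thesis using True far by (auto simp: indicator_def)
  qed
qed

lemma truncated_convolution_le:
  fixes k u w :: "'a::euclidean_space \<Rightarrow> real"
  assumes k0: "\<And>y. 0 \<le> k y" and kint: "integrable lborel k" and k1: "(\<integral>y. k y \<partial>lborel) = 1"
    and kE: "\<And>y. y \<notin> E \<Longrightarrow> k y = 0"
    and um: "(\<lambda>y. indicator E y * u y) \<in> borel_measurable lborel"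
    and uB: "\<And>y. y \<in> E \<Longrightarrow> \<bar>u y\<bar> \<le> B" and wm: "w \<in> borel_measurable lborel"
    and wB: "\<And>y. \<bar>w y\<bar> \<le> B'"
    and le: "\<And>y. y \<in> E \<Longrightarrow> s * u y \<le> w y + m"
  shows "s * (\<integral>y. indicator E y * (k y * (u y - a)) \<partial>lborel) \<le> (\<integral>y. k y * w y \<partial>lborel) + m - s * a"
proof -
  have eq: "indicator E y * (k y * (u y - a)) = k y * (indicator E y * u y - a)" for y
    using kE[of y] by (cases "y \<in> E") auto
  have i1: "integrable lborel (\<lambda>y. k y * (indicator E y * u y - a))"
    using um by (intro integrable_mult_bounded[OF kint, where B="\<bar>B\<bar> + \<bar>a\<bar>"])
      (use uB in \<open>force simp: indicator_def\<close>)+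
  have i2: "integrable lborel (\<lambda>y. k y * w y)" by (rule integrable_mult_bounded[OF kint wm wB])
  have "s * (\<integral>y. indicator E y * (k y * (u y - a)) \<partial>lborel) =
      (\<integral>y. s * (k y * (indicator E y * u y - a)) \<partial>lborel)"
    by (simp add: eq)
  also have "\<dots> \<le> (\<integral>y. k y * w y + k y * (m - s * a) \<partial>lborel)"
  proof (rule integral_mono)
    fix y
    show "s * (k y * (indicator E y * u y - a)) \<le> k y * w y + k y * (m - s * a)"
    proof (cases "y \<in> E")
      case True
      then have "k y * (s * u y - s * a) \<le> k y * (w y + m - s * a)"
        using le[OF True] k0 by (intro mult_left_mono) auto
      then show ?thesis using True by (simp add: algebra_simps)
    qed (simp add: kE)
  qed (use i1 i2 kint in auto)
  also have "\<dots> = (\<integral>y. k y * w y \<partial>lborel) + m - s * a"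
    using i2 kint k1 by simp
  finally show ?thesis .
qed

lemma logistic_exp_le:
  fixes \<nu> a b d :: real
  assumes "\<nu> \<ge> 0" "b \<le> a + d" "d \<ge> 0"
  shows "1 / (1 + exp (- \<nu> * b)) \<le> exp (\<nu> * d) * (1 / (1 + exp (- \<nu> * a)))"
proof -
  have "exp (- (\<nu> * a)) \<le> exp (\<nu> * d) * exp (- (\<nu> * b))"
    using assms mult_left_mono[of b "a + d" \<nu>] by (simp add: algebra_simps flip: exp_add)
  moreover have "1 \<le> exp (\<nu> * d)" using assms by simp
  ultimately have "1 + exp (- (\<nu> * a)) \<le> exp (\<nu> * d) * (1 + exp (- (\<nu> * b)))"
    unfolding distrib_left by linarith
  then show ?thesis by (simp add: divide_simps add_pos_pos)
qed

text \<open>For \<open>s = 1\<close> and \<open>s = - 1\<close> the proof compares \<open>u\<close> with the super- resp. subsolution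
  \<open>\<phi> (x\<^sub>1 + c t + s Z t) + s (q t + p x\<^sub>1)\<close>.  Here \<open>q\<close> decays exponentially in time and
  absorbs the initial error, while \<open>p\<close> is a logistic function that stays above \<open>P / 2\<close> near the
  obstacle and is small at the front once the front has left the obstacle behind.\<close>

lemma front_comparison:
  fixes k :: "real \<times> 'b::euclidean_space \<Rightarrow> real" and Cv \<phi> f :: "real \<Rightarrow> real"
    and u :: "real \<Rightarrow> real \<times> 'b \<Rightarrow> real" and s :: real
  assumes k0: "\<And>z. 0 \<le> k z" and kint: "integrable lborel k" and k1: "(\<integral>z. k z \<partial>lborel) = 1"
    and keven: "\<And>z. k (- z) = k z"
    and \<rho>: "\<rho> > 0" and k\<rho>: "\<And>z. \<rho> \<le> norm z \<Longrightarrow> k z = 0"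
    and Cv: "\<And>x b. (\<integral>y. k (x - y) * \<phi> (fst y + b) \<partial>lborel) = Cv (fst x + b)"
    and mono: "mono \<phi>" and rng: "\<And>\<xi>. 0 \<le> \<phi> \<xi> \<and> \<phi> \<xi> \<le> 1" and c: "c > 0"
    and der: "\<And>\<xi>. (\<phi> has_real_derivative ((Cv \<xi> - \<phi> \<xi> + f (\<phi> \<xi>)) / c)) (at \<xi>)"
    and C0: "C \<ge> 0"
    and flip: "\<And>a b. 0 \<le> a \<Longrightarrow> a \<le> b \<Longrightarrow> b \<le> 1 \<Longrightarrow> f b - f a \<le> C * (b - a)"
    and \<mu>: "\<mu> > 0"
    and fend: "\<And>a b. 0 \<le> a \<Longrightarrow> a \<le> b \<Longrightarrow> b \<le> 1 \<Longrightarrow> b \<le> 2 * \<sigma> \<or> a \<ge> 1 - 2 * \<sigma> \<Longrightarrow>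
        f b - f a \<le> - \<mu> * (b - a)"
    and \<kappa>: "\<kappa> > 0"
    and mid: "\<And>\<xi>. \<sigma> \<le> \<phi> \<xi> \<Longrightarrow> \<phi> \<xi> \<le> 1 - \<sigma> \<Longrightarrow>
        \<xi> \<le> M \<and> \<kappa> \<le> (Cv \<xi> - \<phi> \<xi> + f (\<phi> \<xi>)) / c"
    and q0: "q0 > 0" and P: "P > 0" and small: "q0 + P \<le> \<sigma>" "(C + \<mu>) / \<kappa> * (q0 + P) \<le> c / 2"
    and s: "s = 1 \<or> s = - 1"
    and u_rng: "\<And>t x. R0 \<le> norm x \<Longrightarrow> 0 \<le> u t x \<and> u t x \<le> 1"
    and u_meas: "\<And>t. (\<lambda>y. indicator {y. R0 \<le> norm y} y * u t y) \<in> borel_measurable lborel"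
    and u_diff: "\<And>t x. R0 \<le> norm x \<Longrightarrow> \<exists>D. ((\<lambda>t. u t x) has_real_derivative D) (at t)"
    and u_eq: "\<And>t x. R \<le> norm x \<Longrightarrow> ((\<lambda>t. u t x) has_real_derivative
        ((\<integral>y. indicator {y. R0 \<le> norm y} y * (k (x - y) * (u t y - u t x)) \<partial>lborel) + f (u t x))) (at t)"
    and R: "R \<ge> R0 + \<rho>" and Z0: "Z0 \<ge> 0"
    and init: "\<And>x. R0 \<le> norm x \<Longrightarrow> s * (u T x - \<phi> (fst x + c * T)) \<le> q0"
    and shell: "\<And>t x Z. t \<ge> T \<Longrightarrow> R0 \<le> norm x \<Longrightarrow> norm x \<le> R \<Longrightarrow> Z \<ge> Z0 \<Longrightarrow>
        s * (u t x - \<phi> (fst x + c * t + s * Z)) \<le> P / 2"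
  shows "\<exists>Zm. \<forall>t\<ge>T. \<forall>x. R0 \<le> norm x \<longrightarrow>
        s * (u t x - \<phi> (fst x + c * t + s * Zm)) \<le> q0 + P"
proof -
  define E where "E = {y :: real \<times> 'b. R0 \<le> norm y}"
  define \<psi> where "\<psi> \<xi> = (Cv \<xi> - \<phi> \<xi> + f (\<phi> \<xi>)) / c" for \<xi>
  define \<Lambda> where "\<Lambda> = (C + \<mu>) / \<kappa>"
  define \<nu> where "\<nu> = ln (1 + \<mu>) / \<rho>"
  define B where "B = M + R - c * T + Z0"
  define p where "p a = P * (1 / (1 + exp (- \<nu> * (a + R))))" for a
  define q where "q t = q0 * exp (- \<mu> * (t - T))" for t
  define r where "r t = P * (1 / (1 + exp (- \<nu> * (B - c / 2 * (t - T)))))" for t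
  define Y where "Y t = ln (1 + exp (\<nu> * (B - c / 2 * (t - T))))" for t
  define Z where "Z t = Z0 + \<Lambda> * (q0 / \<mu> * (1 - exp (- \<mu> * (t - T))) + 2 * P / (\<nu> * c) * (Y T - Y t))" for t
  define Zm where "Zm = Z0 + \<Lambda> * (q0 / \<mu> + 2 * P / (\<nu> * c) * Y T)"
  have \<nu>: "\<nu> > 0" using \<mu> \<rho> by (simp add: \<nu>_def)
  have e\<nu>: "exp (\<nu> * \<rho>) = 1 + \<mu>" using \<mu> \<rho> by (simp add: \<nu>_def)
  have \<Lambda>: "\<Lambda> > 0" using C0 \<mu> \<kappa> by (simp add: \<Lambda>_def)
  have s2: "s * s = 1" using s by auto
  have der': "(\<phi> has_real_derivative \<psi> \<xi>) (at \<xi>)" for \<xi> using der by (simp add: \<psi>_def)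
  have \<psi>0: "\<psi> \<xi> \<ge> 0" for \<xi>
    by (rule mono_on_imp_deriv_nonneg[of UNIV, OF _ der']) (use mono in \<open>auto simp: mono_def monotone_on_def\<close>)
  have p_bd: "0 \<le> p a" "p a \<le> P" for a
    using P by (auto simp: p_def divide_simps add_pos_pos)
  have r_bd: "0 \<le> r a" "r a \<le> P" for a
    using P by (auto simp: r_def divide_simps add_pos_pos)
  have q_bd: "0 \<le> q t" "t \<ge> T \<Longrightarrow> q t \<le> q0" for t
    using q0 \<mu> by (auto simp: q_def mult_left_le)
  have Z_der: "(Z has_real_derivative \<Lambda> * (q t + r t)) (at t)" for t
  proof -
    have "(Y has_real_derivative - (\<nu> * (c / 2)) * (1 / (1 + exp (- \<nu> * (B - c / 2 * (t - T)))))) (at t)"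
      unfolding Y_def
      by (auto intro!: derivative_eq_intros simp: add_pos_pos exp_minus divide_simps)
    moreover define G where "G = 1 / (1 + exp (- \<nu> * (B - c / 2 * (t - T))))"
    ultimately have "(Y has_real_derivative - (\<nu> * (c / 2)) * G) (at t)" by (simp only:)
    moreover have "r t = P * G" by (simp only: r_def G_def)
    ultimately show ?thesis unfolding Z_def using \<mu> \<nu> c
      by (auto intro!: derivative_eq_intros simp: q_def)
  qed
  have Z_mono: "Z a \<le> Z b" if "a \<le> b" for a b
  proof (rule DERIV_nonneg_imp_nondecreasing[OF that])
    fix t
    have "0 \<le> \<Lambda> * (q t + r t)" using \<Lambda> q_bd(1)[of t] r_bd(1)[of t] by simp
    then show "\<exists>y. (Z has_real_derivative y) (at t) \<and> 0 \<le> y" using Z_der by blast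
  qed
  have Z_T: "Z T = Z0" by (simp add: Z_def)
  have Y0: "Y t \<ge> 0" for t by (simp add: Y_def)
  have Z_Zm: "Z t \<le> Zm" for t
    unfolding Z_def Zm_def using \<Lambda> \<mu> q0 P \<nu> c Y0
    by (intro add_left_mono mult_left_mono add_mono) (auto simp: mult_left_le divide_right_mono)
  have front: "c * t + s * Z t \<ge> c * T - Z0 + c / 2 * (t - T)" if t: "t \<ge> T" for t
  proof -
    have "c * T + s * Z T - c / 2 * (T - T) \<le> c * t + s * Z t - c / 2 * (t - T)"
    proof (rule DERIV_nonneg_imp_nondecreasing[OF t])
      fix x assume x: "T \<le> x"
      have "\<Lambda> * (q x + r x) \<le> \<Lambda> * (q0 + P)"
        using \<Lambda> q_bd(2)[OF x] r_bd by (intro mult_left_mono add_mono) auto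
      also have "\<dots> \<le> c / 2" using small by (simp add: \<Lambda>_def)
      finally have 1: "\<Lambda> * (q x + r x) \<le> c / 2" .
      have 0: "0 \<le> \<Lambda> * (q x + r x)" using \<Lambda> q_bd(1)[of x] r_bd(1)[of x] by simp
      have "((\<lambda>t. c * t + s * Z t - c / 2 * (t - T)) has_real_derivative (c + s * (\<Lambda> * (q x + r x)) - c / 2)) (at x)"
        by (auto intro!: derivative_eq_intros Z_der)
      moreover have "0 \<le> c + s * (\<Lambda> * (q x + r x)) - c / 2" using s 0 1 c by auto
      ultimately show "\<exists>y. ((\<lambda>t. c * t + s * Z t - c / 2 * (t - T)) has_real_derivative y) (at x) \<and> 0 \<le> y"
        by blast
    qed
    then show ?thesis using s Z_T Z0 by auto
  qed
  have p_r: "p a \<le> r t" if "t \<ge> T" "a + c * t + s * Z t \<le> M" for a t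
  proof -
    have "a + R \<le> B - c / 2 * (t - T)" using front[OF that(1)] that(2) by (simp add: B_def)
    then have "1 / (1 + exp (- \<nu> * (a + R))) \<le> exp (\<nu> * 0) * (1 / (1 + exp (- \<nu> * (B - c / 2 * (t - T)))))"
      using \<nu> by (intro logistic_exp_le) auto
    then have "1 / (1 + exp (- \<nu> * (a + R))) \<le> 1 / (1 + exp (- \<nu> * (B - c / 2 * (t - T))))" by simp
    then show ?thesis unfolding p_def r_def using P by (intro mult_left_mono) auto
  qed
  have kx_int: "integrable lborel (\<lambda>y. k (x - y))" and kx_1: "(\<integral>y. k (x - y) \<partial>lborel) = 1" for x
    using integrable_lborel_translate[OF kint, of x] integral_lborel_translate[OF kint, of x] k1
      keven[of "x - _"] by auto
  have meas_fst: "(\<lambda>y::real \<times> 'b. g (fst y)) \<in> borel_measurable lborel"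
    if "continuous_on UNIV g" for g :: "real \<Rightarrow> real"
    by (simp, intro borel_measurable_continuous_onI continuous_on_compose2[OF that] continuous_intros) auto
  have cont_p: "continuous_on UNIV p"
    unfolding p_def by (intro continuous_intros) (auto simp: add_pos_pos less_imp_neq[THEN not_sym])
  have cont_\<phi>: "continuous_on UNIV (\<lambda>a. \<phi> (a + b))" for b
    by (intro continuous_on_compose2[OF DERIV_continuous_on[of UNIV \<phi> \<psi>]] continuous_intros)
       (use der' in auto)
  have p_meas: "(\<lambda>y::real \<times> 'b. p (fst y)) \<in> borel_measurable lborel" by (rule meas_fst[OF cont_p])
  have \<phi>_meas: "(\<lambda>y::real \<times> 'b. \<phi> (fst y + b)) \<in> borel_measurable lborel" for b
    by (rule meas_fst[OF cont_\<phi>])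
  have p_int: "integrable lborel (\<lambda>y. k (x - y) * p (fst y))" for x
    by (rule integrable_mult_bounded[OF kx_int p_meas, where B=P]) (use p_bd in auto)
  have \<phi>_int: "integrable lborel (\<lambda>y. k (x - y) * \<phi> (fst y + b))" for x b
    by (rule integrable_mult_bounded[OF kx_int \<phi>_meas, where B=1]) (use rng in auto)
  have p_conv: "(\<integral>y. k (x - y) * p (fst y) \<partial>lborel) \<le> (1 + \<mu>) * p (fst x)" for x
  proof -
    have "(\<integral>y. k (x - y) * p (fst y) \<partial>lborel) \<le> (\<integral>y. k (x - y) * ((1 + \<mu>) * p (fst x)) \<partial>lborel)"
    proof (rule integral_mono[OF p_int])
      show "integrable lborel (\<lambda>y. k (x - y) * ((1 + \<mu>) * p (fst x)))" using kx_int by simp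
      fix y
      show "k (x - y) * p (fst y) \<le> k (x - y) * ((1 + \<mu>) * p (fst x))"
      proof (cases "norm (x - y) < \<rho>")
        case True
        have "\<bar>fst x - fst y\<bar> \<le> norm (x - y)" using dist_fst_le[of x y] by (simp add: dist_norm)
        then have "fst y + R \<le> fst x + R + \<rho>" using True by auto
        then have "P * (1 / (1 + exp (- \<nu> * (fst y + R)))) \<le>
            P * (exp (\<nu> * \<rho>) * (1 / (1 + exp (- \<nu> * (fst x + R)))))"
          using \<nu> \<rho> P by (intro mult_left_mono logistic_exp_le) auto
        then have "p (fst y) \<le> (1 + \<mu>) * p (fst x)"
          unfolding p_def e\<nu> by (simp only: mult.left_commute)
        then show ?thesis using k0 by (intro mult_left_mono) auto
      qed (use k\<rho> in auto)
    qed
    then show ?thesis using kx_1 by simp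
  qed
  define v where "v t x = s * (u t x - \<phi> (fst x + c * t + s * Z t)) - q t - p (fst x)" for t x
  have v_le: "v t x \<le> 0" if t: "t \<ge> T" and x: "x \<in> E" for t x
  proof (rule comparison_nonpos[where v=v and E=E and T=T and B=1 and \<Lambda>="1 + C"])
    fix t x assume t: "t \<ge> T" and x: "x \<in> E"
    have "\<bar>u t x - \<phi> (fst x + c * t + s * Z t)\<bar> \<le> 1"
      using u_rng[of x t] rng[of "fst x + c * t + s * Z t"] x unfolding abs_le_iff E_def
      by auto
    then show "v t x \<le> 1" using s p_bd(1)[of "fst x"] q_bd(1)[of t] unfolding v_def by auto
  next
    fix x assume x: "x \<in> E"
    have "\<phi> (fst x + c * T) \<le> \<phi> (fst x + c * T + s * Z0)" if "s = 1"
      using mono Z0 that by (auto simp: mono_def)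
    moreover have "\<phi> (fst x + c * T + s * Z0) \<le> \<phi> (fst x + c * T)" if "s = - 1"
      using mono Z0 that by (auto simp: mono_def)
    moreover have "q T = q0" by (simp add: q_def)
    ultimately show "v T x \<le> 0"
      using s init[of x] x p_bd(1)[of "fst x"] unfolding v_def Z_T E_def by auto
  next
    fix x assume x: "x \<in> E"
    have "continuous_on {T..} (\<lambda>t. u t x)"
      using u_diff[of x] x by (intro continuous_at_imp_continuous_on ballI) (auto simp: E_def dest: DERIV_isCont)
    moreover have "continuous_on {T..} (\<lambda>t. \<phi> (fst x + c * t + s * Z t))"
    proof (intro continuous_at_imp_continuous_on ballI)
      fix t
      show "isCont (\<lambda>t. \<phi> (fst x + c * t + s * Z t)) t"
        by (intro continuous_intros isCont_o2[OF _ DERIV_isCont[OF der']] DERIV_isCont[OF Z_der])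
    qed
    ultimately show "continuous_on {T..} (\<lambda>t. v t x)"
      unfolding v_def q_def by (intro continuous_intros)
  next
    fix t x assume t: "t \<ge> T" and xE: "x \<in> E" and pos: "v t x > 0"
    define \<xi> where "\<xi> = fst x + c * t + s * Z t"
    define I where "I = (\<integral>y. indicator E y * (k (x - y) * (u t y - u t x)) \<partial>lborel)"
    define S where "S = q t + p (fst x)"
    define w where "w = \<phi> \<xi> + s * S"
    have S0: "0 \<le> S" "S \<le> \<sigma>" using p_bd[of "fst x"] q_bd[of t] t small by (auto simp: S_def)
    have ux: "0 \<le> u t x" "u t x \<le> 1" using u_rng xE by (auto simp: E_def)
    have v_w: "v t x = s * (u t x - w)" using s by (auto simp: v_def w_def \<xi>_def S_def)
    have xR: "norm x > R"
    proof (rule ccontr)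
      assume "\<not> norm x > R"
      then have xR: "norm x \<le> R" by simp
      have "fst x \<ge> - R" using dist_fst_le[of x 0] xR by (simp add: dist_norm)
      then have "exp (- \<nu> * (fst x + R)) \<le> 1" using \<nu> by (simp add: mult_nonneg_nonneg)
      then have "1 / 2 \<le> 1 / (1 + exp (- \<nu> * (fst x + R)))"
        by (intro frac_le) (auto simp: add_pos_pos)
      then have "P * (1 / 2) \<le> p (fst x)"
        unfolding p_def using P by (intro mult_left_mono) auto
      moreover have "s * (u t x - \<phi> (fst x + c * t + s * Z t)) \<le> P / 2"
        using xE xR t Z_mono[OF t] Z_T by (intro shell) (auto simp: E_def)
      ultimately show False using pos q_bd(1)[of t] by (simp add: v_def)
    qed
    have d\<xi>: "((\<lambda>t. fst x + c * t + s * Z t) has_real_derivative c + s * (\<Lambda> * (q t + r t))) (at t)"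
      by (auto intro!: derivative_eq_intros Z_der)
    have dq: "(q has_real_derivative - \<mu> * q t) (at t)"
      unfolding q_def by (auto intro!: derivative_eq_intros)
    have "((\<lambda>t. v t x) has_real_derivative
        (s * ((I + f (u t x)) - \<psi> \<xi> * (c + s * (\<Lambda> * (q t + r t)))) - (- \<mu> * q t) - 0)) (at t)"
      unfolding v_def
    proof (intro DERIV_diff DERIV_cmult DERIV_const dq)
      show "((\<lambda>t. u t x) has_real_derivative I + f (u t x)) (at t)"
        using u_eq[of x t] xR by (simp add: I_def E_def)
      show "((\<lambda>t. \<phi> (fst x + c * t + s * Z t)) has_real_derivative \<psi> \<xi> * (c + s * (\<Lambda> * (q t + r t)))) (at t)"
        using DERIV_chain2[OF der' d\<xi>] by (simp add: \<xi>_def)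
    qed
    moreover have "s * ((I + f (u t x)) - \<psi> \<xi> * (c + s * (\<Lambda> * (q t + r t)))) - (- \<mu> * q t) - 0 \<le> (1 + C) * m"
      if m: "m \<ge> 0" "\<forall>y\<in>E. v t y \<le> m" for m
    proof -
      have "s * I \<le> (\<integral>y. k (x - y) * (s * \<phi> (fst y + (c * t + s * Z t)) + q t + p (fst y)) \<partial>lborel) + m - s * u t x"
        unfolding I_def
      proof (rule truncated_convolution_le[where B=1 and B'="1 + q0 + P"])
        show "k (x - y) = 0" if "y \<notin> E" for y
          using that norm_triangle_sub[of x y] xR R by (intro k\<rho>) (auto simp: E_def)
        show "(\<lambda>y. indicator E y * u t y) \<in> borel_measurable lborel"
          using u_meas[of t] by (simp add: E_def)
        show "\<bar>u t y\<bar> \<le> 1" if "y \<in> E" for y using u_rng[of y t] that by (auto simp: E_def)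
        show "(\<lambda>y::real \<times> 'b. s * \<phi> (fst y + (c * t + s * Z t)) + q t + p (fst y)) \<in> borel_measurable lborel"
          by (intro borel_measurable_add borel_measurable_times p_meas \<phi>_meas borel_measurable_const)
        show "\<bar>s * \<phi> (fst y + (c * t + s * Z t)) + q t + p (fst y)\<bar> \<le> 1 + q0 + P" for y :: "real \<times> 'b"
          using s rng[of "fst y + (c * t + s * Z t)"] q_bd(1)[of t] q_bd(2)[OF t] p_bd[of "fst y"] by auto
        show "s * u t y \<le> s * \<phi> (fst y + (c * t + s * Z t)) + q t + p (fst y) + m" if "y \<in> E" for y
          using m(2) that by (auto simp: v_def algebra_simps)
      qed (use k0 kx_int kx_1 in auto)
      also have "(\<integral>y. k (x - y) * (s * \<phi> (fst y + (c * t + s * Z t)) + q t + p (fst y)) \<partial>lborel) =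
          (\<integral>y. s * (k (x - y) * \<phi> (fst y + (c * t + s * Z t))) + k (x - y) * q t + k (x - y) * p (fst y) \<partial>lborel)"
        by (simp add: algebra_simps)
      also have "\<dots> = s * Cv \<xi> + q t + (\<integral>y. k (x - y) * p (fst y) \<partial>lborel)"
        using \<phi>_int[of x "c * t + s * Z t"] p_int[of x] kx_int[of x] kx_1[of x] Cv[of x "c * t + s * Z t"]
        by (simp add: \<xi>_def add.assoc)
      finally have I_le: "s * I \<le> s * Cv \<xi> + q t + (1 + \<mu>) * p (fst x) + m - s * u t x"
        using p_conv[of x] by linarith
      have \<psi>c: "\<psi> \<xi> * c = Cv \<xi> - \<phi> \<xi> + f (\<phi> \<xi>)" using c by (simp add: \<psi>_def)
      have w01: "0 \<le> w" "w \<le> 1"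
        using s pos ux S0 rng[of \<xi>] unfolding v_w by (auto simp: w_def)
      have f1: "s * (f (u t x) - f w) \<le> C * v t x"
        using s pos ux w01 flip[of w "u t x"] flip[of "u t x" w] unfolding v_w by auto
      have key: "s * (f w - f (\<phi> \<xi>)) + \<mu> * S \<le> \<psi> \<xi> * (\<Lambda> * (q t + r t))"
      proof (cases "\<sigma> \<le> \<phi> \<xi> \<and> \<phi> \<xi> \<le> 1 - \<sigma>")
        case True
        have "s * (f w - f (\<phi> \<xi>)) \<le> C * S"
          using s w01 S0 rng[of \<xi>] flip[of w "\<phi> \<xi>"] flip[of "\<phi> \<xi>" w] by (auto simp: w_def)
        moreover have "p (fst x) \<le> r t" using mid[of \<xi>] True by (intro p_r[OF t]) (auto simp: \<xi>_def)
        then have "(C + \<mu>) * S \<le> (C + \<mu>) * (q t + r t)"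
          using C0 \<mu> by (intro mult_left_mono) (auto simp: S_def)
        moreover have "(C + \<mu>) * (q t + r t) = \<kappa> * (\<Lambda> * (q t + r t))" using \<kappa> by (simp add: \<Lambda>_def)
        moreover have "\<dots> \<le> \<psi> \<xi> * (\<Lambda> * (q t + r t))"
          using mid[of \<xi>] True \<Lambda> q_bd(1) r_bd(1) by (intro mult_right_mono) (auto simp: \<psi>_def)
        ultimately show ?thesis by (simp add: algebra_simps)
      next
        case False
        then have "s * (f w - f (\<phi> \<xi>)) \<le> - \<mu> * S"
          using s w01 S0 rng[of \<xi>] fend[of w "\<phi> \<xi>"] fend[of "\<phi> \<xi>" w] by (auto simp: w_def)
        moreover have "0 \<le> \<psi> \<xi> * (\<Lambda> * (q t + r t))"
          using \<psi>0 \<Lambda> q_bd(1) r_bd(1) by simp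
        ultimately show ?thesis by linarith
      qed
      have "s * ((I + f (u t x)) - \<psi> \<xi> * (c + s * (\<Lambda> * (q t + r t)))) =
          s * I + s * f (u t x) - s * (\<psi> \<xi> * c) - s * s * (\<psi> \<xi> * (\<Lambda> * (q t + r t)))"
        by (simp add: algebra_simps)
      also have "\<dots> = s * I + s * f (u t x) - s * (Cv \<xi> - \<phi> \<xi> + f (\<phi> \<xi>)) - \<psi> \<xi> * (\<Lambda> * (q t + r t))"
        by (simp only: \<psi>c s2 mult_1)
      also have "\<dots> \<le> m - v t x + \<mu> * p (fst x) + s * (f (u t x) - f w) + s * (f w - f (\<phi> \<xi>)) - \<psi> \<xi> * (\<Lambda> * (q t + r t))"
        using I_le by (simp add: v_def \<xi>_def algebra_simps)
      also have "\<dots> \<le> m - v t x + C * v t x - \<mu> * q t"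
        using f1 key by (simp add: S_def algebra_simps)
      finally have "s * ((I + f (u t x)) - \<psi> \<xi> * (c + s * (\<Lambda> * (q t + r t)))) - (- \<mu> * q t) - 0 \<le> m - v t x + C * v t x"
        by simp
      also have "\<dots> \<le> m + C * m"
        using m xE pos C0 by (intro add_mono mult_left_mono) auto
      finally show ?thesis by (simp add: algebra_simps)
    qed
    ultimately show "\<exists>D. ((\<lambda>t. v t x) has_real_derivative D) (at t) \<and>
        (\<forall>m\<ge>0. (\<forall>y\<in>E. v t y \<le> m) \<longrightarrow> D \<le> (1 + C) * m)" by blast
  qed (use C0 t x in auto)
  have "s * (u t x - \<phi> (fst x + c * t + s * Zm)) \<le> q0 + P" if t: "t \<ge> T" and x: "R0 \<le> norm x" for t x
  proof -
    have "s * (u t x - \<phi> (fst x + c * t + s * Z t)) \<le> q0 + P"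
      using v_le[OF t, of x] x q_bd(2)[OF t] p_bd(2)[of "fst x"] by (simp add: v_def E_def)
    moreover have "s * \<phi> (fst x + c * t + s * Z t) \<le> s * \<phi> (fst x + c * t + s * Zm)"
      using s Z_Zm[of t] mono by (auto simp: mono_def)
    ultimately show ?thesis by (simp add: algebra_simps)
  qed
  then show ?thesis by blast
qed

theorem theorem2p5:
  fixes K \<Omega> :: "(real \<times> 'b::euclidean_space) set"
    and \<delta> :: "real \<times> 'b \<Rightarrow> real \<times> 'b \<Rightarrow> real"
    and J f fd \<phi> :: "real \<Rightarrow> real"
    and \<theta> c \<alpha> :: real
    and u :: "real \<Rightarrow> real \<times> 'b \<Rightarrow> real"
    and uinf :: "real \<times> 'b \<Rightarrow> real"
  assumes K: "compact K" and Omega: "\<Omega> = - K" and conn: "connected \<Omega>"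
    and qe: "quasi_euclidean (closure \<Omega>) \<delta>"
    \<comment> \<open>(A-f)\<close>
    and f_deriv: "\<forall>s\<in>{0..1}. (f has_real_derivative fd s) (at s within {0..1})"
    and f_C11: "\<exists>L. L-lipschitz_on {0..1} fd"
    and theta: "0 < \<theta>" "\<theta> < 1"
    and f_zeros: "f 0 = 0" "f \<theta> = 0" "f 1 = 0"
    and f_neg: "\<forall>s\<in>{0<..<\<theta>}. f s < 0" and f_pos: "\<forall>s\<in>{\<theta><..<1}. f s > 0"
    and fd_signs: "fd 0 < 0" "fd \<theta> > 0" "fd 1 < 0"
    \<comment> \<open>(A-J)\<close>
    and J_meas: "J \<in> borel_measurable borel"
    and J_nonneg: "\<forall>s\<ge>0. J s \<ge> 0"
    and J_cpt: "\<exists>R. \<forall>s\<ge>R. J s = 0"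
    and J_supp: "emeasure lborel (supp_on {0..} J) > 0"
    and J_cover: "covering_property J \<delta> (closure \<Omega>)"
    and J_int: "integrable lborel (\<lambda>x::real \<times> 'b. J (norm x))"
    and J_int1: "(\<integral>x. J (norm (x::real \<times> 'b)) \<partial>lborel) = 1"
    and J_cont: "\<forall>y\<in>closure \<Omega>. ((\<lambda>z. L1_diff J \<delta> \<Omega> y z) \<longlongrightarrow> 0) (at y within closure \<Omega>)"
    and J_Linf: "\<exists>M::real. AE x in lborel. x \<in> \<Omega> \<longrightarrow> calJ J \<delta> \<Omega> x \<le> ennreal M"
    \<comment> \<open>(A-TW), with (phi, c) fixed\<close>
    and phi_mono: "mono \<phi>" and phi_cont: "continuous_on UNIV \<phi>" and c_pos: "c > 0"
    and TW: "\<forall>\<xi>. (\<phi> has_real_derivative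
               (((\<integral>s. J_one J TYPE('b) (\<xi> - s) * \<phi> s \<partial>lborel) - \<phi> \<xi> + f (\<phi> \<xi>)) / c)) (at \<xi>)"
    and phi_bot: "(\<phi> \<longlongrightarrow> 0) at_bot" and phi_top: "(\<phi> \<longlongrightarrow> 1) at_top"
    \<comment> \<open>(A-5)\<close>
    and J_W11: "(\<lambda>x::real \<times> 'b. J (norm x)) \<in> W11"
    and fd_lt1: "Sup (fd ` {0..1}) < 1"
    and f_int: "(\<integral>s\<in>{0..1}. f s \<partial>lborel) > 0"
    \<comment> \<open>(A-nd): max f' < inf_Omega calJ\<close>
    and nd: "\<exists>m. Sup (fd ` {0..1}) < m \<and> (\<forall>x\<in>\<Omega>. ennreal m \<le> calJ J \<delta> \<Omega> x)"
    \<comment> \<open>J in B^alpha_{1,infty}(Omega;delta)\<close>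
    and alpha: "0 < \<alpha>" "\<alpha> < 1"
    and J_besov: "J \<in> besov_class \<alpha> \<Omega> \<delta>"
    \<comment> \<open>u: bounded entire solution, emanating from the front as t \<rightarrow> -\<infinity>\<close>
    and u_range: "\<forall>t. \<forall>x\<in>closure \<Omega>. 0 \<le> u t x \<and> u t x \<le> 1"
    and u_cont: "continuous_on (UNIV \<times> closure \<Omega>) (\<lambda>(t, x). u t x)"
    and u_eq: "\<forall>t. \<forall>x\<in>closure \<Omega>.
                 ((\<lambda>s. u s x) has_real_derivative (nonlocal_L J \<delta> \<Omega> (u t) x + f (u t x))) (at t)"
    and u_minus: "\<forall>\<epsilon>>0. \<exists>T. \<forall>t\<le>T. \<forall>x\<in>closure \<Omega>. \<bar>u t x - \<phi> (fst x + c * t)\<bar> < \<epsilon>"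
    \<comment> \<open>u_infinity: stationary solution, tending to 1 at infinity\<close>
    and uinf_range: "\<forall>x\<in>closure \<Omega>. 0 \<le> uinf x \<and> uinf x \<le> 1"
    and uinf_cont: "continuous_on (closure \<Omega>) uinf"
    and uinf_eq: "\<forall>x\<in>closure \<Omega>. nonlocal_L J \<delta> \<Omega> uinf x + f (uinf x) = 0"
    and uinf_lim: "\<forall>\<epsilon>>0. \<exists>R. \<forall>x\<in>closure \<Omega>. norm x \<ge> R \<longrightarrow> \<bar>uinf x - 1\<bar> < \<epsilon>"
    and u_plus: "\<forall>C. compact C \<and> C \<subseteq> closure \<Omega> \<longrightarrow>
                 (\<forall>\<epsilon>>0. \<exists>T. \<forall>t\<ge>T. \<forall>x\<in>C. \<bar>u t x - uinf x * \<phi> (fst x + c * t)\<bar> < \<epsilon>)"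
  shows "(\<forall>\<epsilon>>0. \<exists>A0. \<forall>A\<ge>A0. \<forall>t. \<forall>x\<in>closure \<Omega>.
             fst x + c * t \<ge> A \<longrightarrow> \<bar>u t x - uinf x\<bar> \<le> \<epsilon>)
       \<and> (\<forall>\<epsilon>>0. \<exists>A0. \<forall>A\<ge>A0. \<forall>t. \<forall>x\<in>closure \<Omega>.
             fst x + c * t \<le> - A \<longrightarrow> u t x \<le> \<epsilon>)"
proof -
  define k where "k z = J (norm z)" for z :: "real \<times> 'b"
  define Cv where "Cv \<xi> = (\<integral>s. J_one J TYPE('b) (\<xi> - s) * \<phi> s \<partial>lborel)" for \<xi>
  obtain \<rho>0 where "\<forall>s\<ge>\<rho>0. J s = 0" using J_cpt by blast
  then obtain \<rho> where \<rho>: "\<rho> > 0" and J\<rho>: "\<And>s. s \<ge> \<rho> \<Longrightarrow> J s = 0"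
    by (intro that[of "max \<rho>0 1"]) auto
  have k0: "0 \<le> k z" for z using J_nonneg by (simp add: k_def)
  have kint: "integrable lborel k" and k1: "(\<integral>z. k z \<partial>lborel) = 1"
    using J_int J_int1 by (simp_all add: k_def[abs_def])
  have rng: "0 \<le> \<phi> \<xi> \<and> \<phi> \<xi> \<le> 1" for \<xi>
  proof
    show "0 \<le> \<phi> \<xi>"
      by (rule tendsto_upperbound[OF phi_bot])
        (use phi_mono in \<open>auto simp: eventually_at_bot_linorder mono_def intro: exI[of _ \<xi>]\<close>)
    show "\<phi> \<xi> \<le> 1"
      by (rule tendsto_lowerbound[OF phi_top])
        (use phi_mono in \<open>auto simp: eventually_at_top_linorder mono_def intro: exI[of _ \<xi>]\<close>)
  qed
  have \<phi>m: "\<phi> \<in> borel_measurable borel" using phi_cont by (rule borel_measurable_continuous_onI)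
  have \<phi>le: "\<phi> a \<le> \<phi> b" if "a \<le> b" for a b using phi_mono that by (rule monoD)
  have Cv: "(\<integral>y. k (x - y) * \<phi> (fst y + b) \<partial>lborel) = Cv (fst x + b)" for x b
    unfolding k_def Cv_def
    by (rule convolution_first_coordinate[OF J_int \<phi>m, where B=1]) (use rng in auto)
  have der: "(\<phi> has_real_derivative ((Cv \<xi> - \<phi> \<xi> + f (\<phi> \<xi>)) / c)) (at \<xi>)" for \<xi>
    using TW by (simp add: Cv_def)
  have Cv_mono: "mono Cv"
  proof (rule monoI)
    fix a b :: real assume ab: "a \<le> b"
    have int: "integrable lborel (\<lambda>y. k (0 - y) * \<phi> (fst y + d))" for d
    proof (rule integrable_mult_bounded[where B=1])
      show "integrable lborel (\<lambda>y. k (0 - y))" using J_int by (simp add: k_def)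
      show "(\<lambda>y::real \<times> 'b. \<phi> (fst y + d)) \<in> borel_measurable lborel"
        by (rule measurable_compose[OF _ \<phi>m])
          (simp, intro borel_measurable_continuous_onI continuous_intros)
    qed (use rng in auto)
    have "(\<integral>y. k (0 - y) * \<phi> (fst y + a) \<partial>lborel) \<le> (\<integral>y. k (0 - y) * \<phi> (fst y + b) \<partial>lborel)"
      by (rule integral_mono[OF int int]) (use ab k0 \<phi>le in \<open>auto intro!: mult_left_mono\<close>)
    then show "Cv a \<le> Cv b" using Cv[of 0 a] Cv[of 0 b] by simp
  qed
  have "continuous_on {0..1} fd" using f_C11 lipschitz_on_continuous_on by blast
  then obtain C \<mu> \<sigma> where C0: "C \<ge> 0" and \<mu>: "\<mu> > 0" and \<sigma>: "\<sigma> > 0"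
    and flip: "\<And>a b. 0 \<le> a \<Longrightarrow> a \<le> b \<Longrightarrow> b \<le> 1 \<Longrightarrow> \<bar>f b - f a\<bar> \<le> C * (b - a)"
    and fend: "\<And>a b. 0 \<le> a \<Longrightarrow> a \<le> b \<Longrightarrow> b \<le> 1 \<Longrightarrow> b \<le> 2 * \<sigma> \<or> a \<ge> 1 - 2 * \<sigma> \<Longrightarrow>
        f b - f a \<le> - \<mu> * (b - a)"
    using bistable_bounds[of f fd] f_deriv fd_signs by metis
  have top: "\<exists>\<xi>0. \<forall>\<xi>\<ge>\<xi>0. 1 - \<eta> < \<phi> \<xi>" if "\<eta> > 0" for \<eta>
    using order_tendstoD(1)[OF phi_top, of "1 - \<eta>"] that by (auto simp: eventually_at_top_linorder)
  have bot: "\<exists>\<xi>0. \<forall>\<xi>\<le>\<xi>0. \<phi> \<xi> < \<eta>" if "\<eta> > 0" for \<eta>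
    using order_tendstoD(2)[OF phi_bot, of \<eta>] that by (auto simp: eventually_at_bot_linorder)
  obtain M where M: "\<And>\<xi>. \<xi> \<ge> M \<Longrightarrow> 1 - \<sigma> < \<phi> \<xi>" using top[OF \<sigma>] by blast
  obtain \<kappa> where \<kappa>: "\<kappa> > 0"
    and slope: "\<And>\<xi>. \<xi> \<le> M \<Longrightarrow> \<sigma> \<le> \<phi> \<xi> \<Longrightarrow> \<kappa> \<le> (Cv \<xi> - \<phi> \<xi> + f (\<phi> \<xi>)) / c"
    using wave_slope_lower_bound[OF phi_mono rng c_pos der Cv_mono flip phi_bot \<sigma>, of M] by blast
  have mid: "\<xi> \<le> M \<and> \<kappa> \<le> (Cv \<xi> - \<phi> \<xi> + f (\<phi> \<xi>)) / c" if "\<sigma> \<le> \<phi> \<xi>" "\<phi> \<xi> \<le> 1 - \<sigma>" for \<xi>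
    using M[of \<xi>] slope[of \<xi>] that by linarith
  define \<Lambda> where "\<Lambda> = (C + \<mu>) / \<kappa>"
  have \<Lambda>: "\<Lambda> > 0" using C0 \<mu> \<kappa> by (simp add: \<Lambda>_def)
  obtain RK where RK: "\<And>z. z \<in> K \<Longrightarrow> norm z < RK"
    using compact_imp_bounded[OF K] unfolding bounded_pos_less by blast
  have ext: "x \<in> closure \<Omega>" if "RK \<le> norm x" for x
    using RK[of x] that closure_subset[of \<Omega>] unfolding Omega by force
  have trap: "\<exists>Zm. \<forall>t\<ge>T. \<forall>x. R0 \<le> norm x \<longrightarrow>
        s * (u t x - \<phi> (fst x + c * t + s * Zm)) \<le> \<eta> + \<eta>"
    if "\<eta> > 0" "\<eta> + \<eta> \<le> \<sigma>" "\<Lambda> * (\<eta> + \<eta>) \<le> c / 2" "s = 1 \<or> s = - 1" "RK \<le> R0" "Z0 \<ge> 0"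
      "\<And>x. R0 \<le> norm x \<Longrightarrow> s * (u T x - \<phi> (fst x + c * T)) \<le> \<eta>"
      "\<And>t x Z. t \<ge> T \<Longrightarrow> R0 \<le> norm x \<Longrightarrow> norm x \<le> R0 + \<rho> \<Longrightarrow> Z \<ge> Z0 \<Longrightarrow>
        s * (u t x - \<phi> (fst x + c * t + s * Z)) \<le> \<eta> / 2"
    for \<eta> s R0 Z0 T
  proof (rule front_comparison[where k=k and Cv=Cv and f=f and \<mu>=\<mu> and \<sigma>=\<sigma> and \<kappa>=\<kappa> and M=M
        and C=C and \<rho>=\<rho> and R="R0 + \<rho>" and ?Z0.0=Z0])
    show "k (- z) = k z" for z by (simp add: k_def)
    show "k z = 0" if "\<rho> \<le> norm z" for z using J\<rho>[OF that] by (simp add: k_def)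
    show "f b - f a \<le> C * (b - a)" if "0 \<le> a" "a \<le> b" "b \<le> 1" for a b
      using flip[OF that] by linarith
    show "0 \<le> u t x \<and> u t x \<le> 1" if "R0 \<le> norm x" for t x
      using u_range ext[of x] that \<open>RK \<le> R0\<close> by auto
    show "(\<lambda>y. indicator {y. R0 \<le> norm y} y * u t y) \<in> borel_measurable lborel" for t
    proof -
      have cl: "closed {y :: real \<times> 'b. R0 \<le> norm y}" by (intro closed_Collect_le continuous_intros)
      have "continuous_on (closure \<Omega>) (\<lambda>y. (\<lambda>(t, x). u t x) (t, y))"
        by (rule continuous_on_compose2[OF u_cont]) (auto intro!: continuous_intros)
      then have "continuous_on {y. R0 \<le> norm y} (u t)"
        using ext \<open>RK \<le> R0\<close> by (auto intro: continuous_on_subset)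
      from borel_measurable_continuous_on_indicator[OF borel_closed[OF cl] this]
      show ?thesis by simp
    qed
    show "\<exists>D. ((\<lambda>t. u t x) has_real_derivative D) (at t)" if "R0 \<le> norm x" for t x
      using u_eq ext[of x] that \<open>RK \<le> R0\<close> by auto
    show "((\<lambda>t. u t x) has_real_derivative
        ((\<integral>y. indicator {y. R0 \<le> norm y} y * (k (x - y) * (u t y - u t x)) \<partial>lborel) + f (u t x))) (at t)"
      if "R0 + \<rho> \<le> norm x" for t x
    proof -
      have "nonlocal_L J \<delta> \<Omega> (u t) x =
          (\<integral>y. indicator {y. R0 \<le> norm y} y * (k (x - y) * (u t y - u t x)) \<partial>lborel)"
        unfolding k_def using RK \<open>RK \<le> R0\<close> that J\<rho> \<rho>
        by (intro nonlocal_L_exterior[OF _ Omega qe]) force+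
      then show ?thesis using u_eq ext[of x] that \<rho> \<open>RK \<le> R0\<close> by (metis add_increasing2 less_imp_le order_trans)
    qed
  qed (use that k0 kint k1 \<rho> Cv phi_mono rng c_pos der C0 \<mu> fend \<kappa> mid in \<open>auto simp: \<Lambda>_def\<close>)
  have small: "\<exists>\<eta>>0. \<eta> + \<eta> \<le> \<sigma> \<and> \<Lambda> * (\<eta> + \<eta>) \<le> c / 2 \<and> \<eta> \<le> \<epsilon> / 8 \<and> \<eta> \<le> 1" if "\<epsilon> > 0" for \<epsilon>
  proof -
    define \<eta> where "\<eta> = min (min (\<sigma> / 2) (c / (4 * \<Lambda>))) (min (\<epsilon> / 8) 1)"
    have "\<eta> \<le> c / (4 * \<Lambda>)" by (simp add: \<eta>_def)
    then have "\<Lambda> * (\<eta> + \<eta>) \<le> c / 2" using \<Lambda> by (simp add: field_simps)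
    moreover have "\<eta> > 0" using \<sigma> c_pos \<Lambda> that by (simp add: \<eta>_def)
    moreover have "\<eta> + \<eta> \<le> \<sigma>" "\<eta> \<le> \<epsilon> / 8" "\<eta> \<le> 1" by (auto simp: \<eta>_def)
    ultimately show ?thesis by blast
  qed
  have u01: "0 \<le> u t x \<and> u t x \<le> 1" if "x \<in> closure \<Omega>" for t x using u_range that by blast
  have fst_le: "\<bar>fst x\<bar> \<le> norm x" for x :: "real \<times> 'b" using dist_fst_le[of x 0] by (simp add: dist_norm)
  have behind: "\<exists>A0. \<forall>A\<ge>A0. \<forall>t. \<forall>x\<in>closure \<Omega>. fst x + c * t \<le> - A \<longrightarrow> u t x \<le> \<epsilon>" if \<epsilon>: "\<epsilon> > 0" for \<epsilon>
  proof -
    obtain \<eta> where \<eta>: "\<eta> > 0" "\<eta> + \<eta> \<le> \<sigma>" "\<Lambda> * (\<eta> + \<eta>) \<le> c / 2" "\<eta> \<le> \<epsilon> / 8"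
      using small[OF \<epsilon>] by blast
    obtain T where T: "\<And>t x. t \<le> T \<Longrightarrow> x \<in> closure \<Omega> \<Longrightarrow> \<bar>u t x - \<phi> (fst x + c * t)\<bar> < \<eta>"
      using u_minus \<eta>(1) by blast
    obtain \<xi>1 where \<xi>1: "\<And>\<xi>. \<xi> \<ge> \<xi>1 \<Longrightarrow> 1 - \<eta> / 2 < \<phi> \<xi>" using top[of "\<eta> / 2"] \<eta>(1) by auto
    obtain \<xi>0 where \<xi>0: "\<And>\<xi>. \<xi> \<le> \<xi>0 \<Longrightarrow> \<phi> \<xi> < \<epsilon> / 4" using bot[of "\<epsilon> / 4"] \<epsilon> by auto
    define Z0 where "Z0 = max 0 (\<xi>1 + (RK + \<rho>) - c * T)"
    have "\<exists>Zm. \<forall>t\<ge>T. \<forall>x. RK \<le> norm x \<longrightarrow> 1 * (u t x - \<phi> (fst x + c * t + 1 * Zm)) \<le> \<eta> + \<eta>"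
    proof (rule trap[OF \<eta>(1-3), where ?Z0.0=Z0])
      show "1 * (u T x - \<phi> (fst x + c * T)) \<le> \<eta>" if "RK \<le> norm x" for x
        using T[of T x] ext[OF that] by auto
      fix t Z :: real and x :: "real \<times> 'b" assume a: "t \<ge> T" "RK \<le> norm x" "norm x \<le> RK + \<rho>" "Z \<ge> Z0"
      have "c * T \<le> c * t" using a c_pos by simp
      then have "\<xi>1 \<le> fst x + c * t + 1 * Z" using fst_le[of x] a by (auto simp: Z0_def)
      then show "1 * (u t x - \<phi> (fst x + c * t + 1 * Z)) \<le> \<eta> / 2"
        using \<xi>1[of "fst x + c * t + 1 * Z"] u01[OF ext[OF a(2)], of t] by auto
    qed (auto simp: Z0_def)
    then obtain Zm where Zm: "\<And>t x. t \<ge> T \<Longrightarrow> RK \<le> norm x \<Longrightarrow> u t x - \<phi> (fst x + c * t + Zm) \<le> \<eta> + \<eta>"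
      unfolding mult_1 by blast
    show ?thesis
    proof (intro exI allI impI ballI)
      fix A t :: real and x :: "real \<times> 'b" assume A: "A \<ge> max (max (Zm - \<xi>0) (- \<xi>0)) (RK - c * T)"
        and x: "x \<in> closure \<Omega>" and le: "fst x + c * t \<le> - A"
      consider "t \<le> T" | "t > T" "RK \<le> norm x" | "t > T" "norm x < RK" by linarith
      then show "u t x \<le> \<epsilon>"
      proof cases
        case 1
        then show ?thesis using T[OF 1 x] \<xi>0[of "fst x + c * t"] A le \<eta>(4) \<epsilon> by auto
      next
        case 2
        then show ?thesis using Zm[of t x] \<xi>0[of "fst x + c * t + Zm"] A le \<eta>(4) \<epsilon> by auto
      next
        case 3
        have "c * t \<le> c * T" using 3 fst_le[of x] A le by auto
        then show ?thesis using 3 c_pos by simp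
      qed
    qed
  qed
  have ahead: "\<exists>A0. \<forall>A\<ge>A0. \<forall>t. \<forall>x\<in>closure \<Omega>. fst x + c * t \<ge> A \<longrightarrow> \<bar>u t x - uinf x\<bar> \<le> \<epsilon>" if \<epsilon>: "\<epsilon> > 0" for \<epsilon>
  proof -
    obtain \<eta> where \<eta>: "\<eta> > 0" "\<eta> + \<eta> \<le> \<sigma>" "\<Lambda> * (\<eta> + \<eta>) \<le> c / 2" "\<eta> \<le> \<epsilon> / 8" "\<eta> \<le> 1"
      using small[OF \<epsilon>] by blast
    obtain R1 where R1: "\<And>x. x \<in> closure \<Omega> \<Longrightarrow> norm x \<ge> R1 \<Longrightarrow> \<bar>uinf x - 1\<bar> < \<eta> / 4"
      using uinf_lim \<eta>(1) by (metis zero_less_divide_iff zero_less_numeral)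
    define R0 where "R0 = max R1 RK"
    have RK0: "RK \<le> R0" by (simp add: R0_def)
    have uinf_ge: "1 - \<eta> / 4 < uinf x" if "R0 \<le> norm x" for x
    proof -
      have "\<bar>uinf x - 1\<bar> < \<eta> / 4" using R1[OF ext, of x] that by (simp add: R0_def)
      then show ?thesis by linarith
    qed
    define Q where "Q = closure \<Omega> \<inter> cball 0 (R0 + \<rho>)"
    have Q: "compact Q" "Q \<subseteq> closure \<Omega>" by (auto simp: Q_def closed_Int_compact)
    have up: "\<exists>T. \<forall>t\<ge>T. \<forall>x\<in>Q. \<bar>u t x - uinf x * \<phi> (fst x + c * t)\<bar> < d" if "d > 0" for d
      using u_plus Q that by blast
    obtain T1 where T1: "\<And>t x. t \<le> T1 \<Longrightarrow> x \<in> closure \<Omega> \<Longrightarrow> \<bar>u t x - \<phi> (fst x + c * t)\<bar> < \<eta>"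
      using u_minus \<eta>(1) by blast
    obtain \<xi>1 where \<xi>1: "\<And>\<xi>. \<xi> \<ge> \<xi>1 \<Longrightarrow> 1 - \<eta> / 8 < \<phi> \<xi>" using top[of "\<eta> / 8"] \<eta>(1) by auto
    obtain \<xi>2 where \<xi>2: "\<And>\<xi>. \<xi> \<le> \<xi>2 \<Longrightarrow> \<phi> \<xi> < \<eta> / 2" using bot[of "\<eta> / 2"] \<eta>(1) by auto
    obtain \<xi>3 where \<xi>3: "\<And>\<xi>. \<xi> \<ge> \<xi>3 \<Longrightarrow> 1 - \<epsilon> / 4 < \<phi> \<xi>" using top[of "\<epsilon> / 4"] \<epsilon> by auto
    obtain T3 where T3: "\<And>t x. t \<ge> T3 \<Longrightarrow> x \<in> Q \<Longrightarrow> \<bar>u t x - uinf x * \<phi> (fst x + c * t)\<bar> < \<eta> / 8"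
      using up[of "\<eta> / 8"] \<eta>(1) by auto
    define T2 where "T2 = max T3 ((\<xi>1 + R0 + \<rho>) / c)"
    have cT2: "c * T2 \<ge> \<xi>1 + R0 + \<rho>"
      using c_pos by (simp add: T2_def max_def field_simps)
    define Z0 where "Z0 = max 0 (R0 + \<rho> + c * T2 - \<xi>2)"
    have "\<exists>Zm. \<forall>t\<ge>T1. \<forall>x. R0 \<le> norm x \<longrightarrow> - 1 * (u t x - \<phi> (fst x + c * t + - 1 * Zm)) \<le> \<eta> + \<eta>"
    proof (rule trap[OF \<eta>(1-3), where ?Z0.0=Z0])
      show "- 1 * (u T1 x - \<phi> (fst x + c * T1)) \<le> \<eta>" if "R0 \<le> norm x" for x
        using T1[of T1 x] ext[of x] RK0 that by auto
      fix t Z :: real and x :: "real \<times> 'b" assume a: "t \<ge> T1" "R0 \<le> norm x" "norm x \<le> R0 + \<rho>" "Z \<ge> Z0"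
      have xc: "x \<in> closure \<Omega>" using ext a RK0 by auto
      show "- 1 * (u t x - \<phi> (fst x + c * t + - 1 * Z)) \<le> \<eta> / 2"
      proof (cases "t \<le> T2")
        case True
        then have "c * t \<le> c * T2" using c_pos by simp
        then have "fst x + c * t + - 1 * Z \<le> \<xi>2" using fst_le[of x] a by (auto simp: Z0_def)
        then show ?thesis using \<xi>2[of "fst x + c * t + - 1 * Z"] u01[OF xc, of t] by auto
      next
        case False
        then have "c * T2 \<le> c * t" using c_pos by simp
        then have "\<xi>1 \<le> fst x + c * t" using fst_le[of x] a cT2 by auto
        then have "(1 - \<eta> / 4) * (1 - \<eta> / 8) \<le> uinf x * \<phi> (fst x + c * t)"
          using \<xi>1[of "fst x + c * t"] uinf_ge[OF a(2)] \<eta>(1,5) by (intro mult_mono) auto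
        moreover have "1 - \<eta> / 4 - \<eta> / 8 \<le> (1 - \<eta> / 4) * (1 - \<eta> / 8)" using \<eta>(1) by (simp add: algebra_simps)
        ultimately have "1 - \<eta> / 4 - \<eta> / 8 \<le> uinf x * \<phi> (fst x + c * t)" by (rule order_trans[rotated])
        moreover have "\<bar>u t x - uinf x * \<phi> (fst x + c * t)\<bar> < \<eta> / 8"
          using T3[of t x] False a xc by (auto simp: T2_def Q_def)
        moreover have "\<phi> (fst x + c * t + - 1 * Z) \<le> 1" using rng by blast
        ultimately have "1 - u t x \<le> \<eta> / 2" "\<phi> (fst x + c * t + - 1 * Z) \<le> 1"
          unfolding abs_less_iff by linarith+
        then show ?thesis by simp
      qed
    qed (use RK0 in \<open>auto simp: Z0_def\<close>)
    then obtain Zm where Zm: "\<And>t x. t \<ge> T1 \<Longrightarrow> R0 \<le> norm x \<Longrightarrow>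
        - 1 * (u t x - \<phi> (fst x + c * t + - 1 * Zm)) \<le> \<eta> + \<eta>"
      by blast
    show ?thesis
    proof (intro exI allI impI ballI)
      fix A t :: real and x :: "real \<times> 'b" assume A: "A \<ge> max (max (Zm + \<xi>3) \<xi>3) (R0 + c * T3)"
        and x: "x \<in> closure \<Omega>" and ge: "fst x + c * t \<ge> A"
      have v01: "0 \<le> u t x" "u t x \<le> 1" "0 \<le> uinf x" "uinf x \<le> 1" using u01[OF x] uinf_range x by auto
      show "\<bar>u t x - uinf x\<bar> \<le> \<epsilon>"
      proof (cases "R0 \<le> norm x")
        case True
        have "u t x \<ge> 1 - \<epsilon> / 2"
        proof (cases "t \<le> T1")
          case True
          then show ?thesis using T1[OF True x] \<xi>3[of "fst x + c * t"] A ge \<eta>(4) \<epsilon> by auto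
        next
          case False
          then show ?thesis using Zm[of t x] \<open>R0 \<le> norm x\<close> \<xi>3[of "fst x + c * t - Zm"] A ge \<eta>(4) \<epsilon> by auto
        qed
        then show ?thesis using uinf_ge[OF True] v01 \<eta>(4) \<epsilon> by (auto simp: abs_le_iff)
      next
        case False
        have "c * T3 \<le> c * t" using False fst_le[of x] A ge by auto
        then have "T3 \<le> t" using c_pos by simp
        then have 1: "\<bar>u t x - uinf x * \<phi> (fst x + c * t)\<bar> < \<eta> / 8"
          using T3[of t x] False x \<rho> by (auto simp: Q_def)
        have "1 - \<epsilon> / 4 < \<phi> (fst x + c * t)" using \<xi>3 A ge by auto
        then have "uinf x * (1 - \<phi> (fst x + c * t)) \<le> 1 * (\<epsilon> / 4)"
          using v01 rng[of "fst x + c * t"] by (intro mult_mono) auto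
        moreover have "0 \<le> uinf x * (1 - \<phi> (fst x + c * t))"
          using v01 rng[of "fst x + c * t"] by simp
        ultimately have "\<bar>uinf x - uinf x * \<phi> (fst x + c * t)\<bar> \<le> \<epsilon> / 4"
          by (simp add: right_diff_distrib)
        then show ?thesis using 1 \<eta>(4) \<epsilon> by linarith
      qed
    qed
  qed
  show ?thesis using behind ahead by blast
qed

end
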